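(* Let $D\subset\mathbb{R}^\eta$ be a bounded polyhedron and let $f^k(x)=w^k\cdot x+b^k$, $k\in\{1,\dots,d\}$, be affine functions on $D$ that are irreducible (for every $k$ there is $x\in D$ with $f^k(x)>f^\ell(x)$ for all $\ell\ne k$). Let $R_{\mathrm{ideal}}$ be the set of all $(x,y,z)\in D\times\mathbb{R}\times\Delta^d$ satisfying $$\underline{g}(x,z)\le y\le \bar{g}(x,z).$$ Then $R_{\mathrm{ideal}}$ is polyhedral, and $R_{\mathrm{ideal}}=R_{\mathrm{cayley}}$.
   Context: $\Delta^d=\{z\in\mathbb{R}^d_{\ge0}:\sum_k z_k=1\}$. For $t\ge 0$ and $A\subseteq\mathbb{R}^\eta$, $t\cdot A=\{ta: a\in A\}$. $D_{|k}=\{x\in D: w^k\cdot x+b^k\ge w^\ell\cdot x+b^\ell\ \ \forall \ell\ne k\}$. The Cayley embedding is $R_{\mathrm{cayley}}=\operatorname{Conv}\left(\bigcup_{k=1}^d\{(x,f^k(x),\mathbf{e}^k): x\in D_{|k}\}\right)\subset\mathbb{R}^{\eta+1+d}$, where $\mathbf{e}^k$ is the $k$-th unit vector of $\mathbb{R}^d$. For $(x,z)\in D\times\Delta^d$, $\bar g(x,z)$ (respectively $\underline g(x,z)$) is the maximum (respectively minimum) of $\sum_{k=1}^d (w^k\cdot\tilde x^k+b^kz_k)$ over all $\tilde x^1,\dots,\tilde x^d\in\mathbb{R}^\eta$ with $x=\sum_{k=1}^d\tilde x^k$ and $\tilde x^k\in z_k\cdot D_{|k}$ for all $k$. If no such $\tilde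 x^1,\dots,\tilde x^d$ exist, then $\bar g(x,z)=-\infty$ and $\underline g(x,z)=+\infty$. *)

theory Defs
  imports "HOL-Analysis.Analysis"
begin

definition unit_simplex :: "(real^'d) set" where
  "unit_simplex = {z. (\<forall>k. 0 \<le> z $ k) \<and> (\<Sum>k\<in>UNIV. z $ k) = 1}"

definition scale_set :: "real \<Rightarrow> 'a::real_vector set \<Rightarrow> 'a set" where
  "scale_set t A = (\<lambda>a. t *\<^sub>R a) ` A"

definition affine_fun :: "('d \<Rightarrow> real^'n) \<Rightarrow> ('d \<Rightarrow> real) \<Rightarrow> 'd \<Rightarrow> real^'n \<Rightarrow> real" where
  "affine_fun w b k x = w k \<bullet> x + b k"

definition irreducible_on ::
    "(real^'n) set \<Rightarrow> ('d \<Rightarrow> real^'n) \<Rightarrow> ('d \<Rightarrow> real) \<Rightarrow> bool" where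
  "irreducible_on D w b \<longleftrightarrow>
    (\<forall>k. \<exists>x\<in>D. \<forall>l. l \<noteq> k \<longrightarrow> affine_fun w b k x > affine_fun w b l x)"

definition max_region ::
    "(real^'n) set \<Rightarrow> ('d \<Rightarrow> real^'n) \<Rightarrow> ('d \<Rightarrow> real) \<Rightarrow> 'd \<Rightarrow> (real^'n) set" where
  "max_region D w b k =
    {x \<in> D. \<forall>l. l \<noteq> k \<longrightarrow> w k \<bullet> x + b k \<ge> w l \<bullet> x + b l}"

definition R_cayley ::
    "(real^'n) set \<Rightarrow> ('d::finite \<Rightarrow> real^'n) \<Rightarrow> ('d \<Rightarrow> real) \<Rightarrow> ((real^'n) \<times> real \<times> (real^'d)) set" where
  "R_cayley D w b =
    convex hull (\<Union>k. {(x, affine_fun w b k x, axis k 1) | x. x \<in> max_region D w b k})"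

definition g_values ::
    "(real^'n) set \<Rightarrow> ('d::finite \<Rightarrow> real^'n) \<Rightarrow> ('d \<Rightarrow> real) \<Rightarrow> real^'n \<Rightarrow> real^'d \<Rightarrow> real set" where
  "g_values D w b x z =
    {\<Sum>k\<in>UNIV. w k \<bullet> xt k + b k * z $ k | xt.
       x = (\<Sum>k\<in>UNIV. xt k) \<and> (\<forall>k. xt k \<in> scale_set (z $ k) (max_region D w b k))}"

text \<open>The two bounds are a genuine maximum and minimum (not a supremum and infimum):
  \<open>GREATEST\<close> and \<open>LEAST\<close> are unspecified unless the optimum is attained.\<close>

definition g_upper ::
    "(real^'n) set \<Rightarrow> ('d::finite \<Rightarrow> real^'n) \<Rightarrow> ('d \<Rightarrow> real) \<Rightarrow> real^'n \<Rightarrow> real^'d \<Rightarrow> ereal" where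
  "g_upper D w b x z =
    (if g_values D w b x z = {} then - \<infinity>
     else ereal (GREATEST v. v \<in> g_values D w b x z))"

definition g_lower ::
    "(real^'n) set \<Rightarrow> ('d::finite \<Rightarrow> real^'n) \<Rightarrow> ('d \<Rightarrow> real) \<Rightarrow> real^'n \<Rightarrow> real^'d \<Rightarrow> ereal" where
  "g_lower D w b x z =
    (if g_values D w b x z = {} then \<infinity>
     else ereal (LEAST v. v \<in> g_values D w b x z))"

definition R_ideal ::
    "(real^'n) set \<Rightarrow> ('d::finite \<Rightarrow> real^'n) \<Rightarrow> ('d \<Rightarrow> real) \<Rightarrow> ((real^'n) \<times> real \<times> (real^'d)) set" where
  "R_ideal D w b =
    {(x, y, z). x \<in> D \<and> z \<in> unit_simplex \<and>
       g_lower D w b x z \<le> ereal y \<and> ereal y \<le> g_upper D w b x z}"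

end

theory Submission
  imports Defs
begin

text \<open>A point \<open>(x, y, z)\<close> lies in the convex hull of the pieces
  \<open>{(x, f\<^sup>k x, e\<^sup>k). x \<in> D\<^sub>k}\<close> iff its convex multipliers are the
  coordinates of \<open>z\<close> and \<open>y\<close> is one of the values over which the bounds are optimised. Hence
  the feasible values at \<open>(x, z)\<close> form a section of the Cayley embedding; being a section of
  a polytope, this set of reals is compact and convex, so it is the interval between its minimum and
  its maximum.\<close>

text \<open>Each polytope may be replaced by a finite generating set; the union of these sets is
  again finite and generates the same hull.\<close>

lemma polytope_convex_hull_UN:
  fixes S :: "'i \<Rightarrow> 'a::real_vector set"
  assumes "finite I" and "\<And>i. i \<in> I \<Longrightarrow> polytope (S i)"
  shows "polytope (convex hull (\<Union>i\<in>I. S i))"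
proof -
  have "\<forall>i\<in>I. \<exists>V. finite V \<and> S i = convex hull V"
    using assms(2) by (simp add: polytope_def)
  then obtain V where V: "\<And>i. i \<in> I \<Longrightarrow> finite (V i) \<and> S i = convex hull (V i)"
    by metis
  have "convex hull (\<Union>i\<in>I. S i) = convex hull (\<Union>i\<in>I. V i)"
  proof (rule hull_unique)
    show "(\<Union>i\<in>I. S i) \<subseteq> convex hull (\<Union>i\<in>I. V i)"
    proof (rule UN_least)
      fix i assume "i \<in> I"
      then have "V i \<subseteq> (\<Union>i\<in>I. V i)" by blast
      then show "S i \<subseteq> convex hull (\<Union>i\<in>I. V i)"
        using V[OF \<open>i \<in> I\<close>] hull_mono by metis
    qed
    show "convex hull (\<Union>i\<in>I. V i) \<subseteq> T" if "(\<Union>i\<in>I. S i) \<subseteq> T" "convex T" for T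
    proof (rule hull_minimal)
      show "(\<Union>i\<in>I. V i) \<subseteq> T"
        using V that(1) hull_subset[of _ convex] by fastforce
    qed (use that in simp)
  qed simp
  moreover have "finite (\<Union>i\<in>I. V i)"
    using V assms(1) by blast
  ultimately show ?thesis
    unfolding polytope_def by blast
qed

text \<open>Compactness and nonemptiness make both extrema attained, so that \<open>LEAST\<close>
  and \<open>GREATEST\<close> denote them; convexity fills in everything between.\<close>

lemma compact_convex_real_iff_between_Least_Greatest:
  fixes S :: "real set"
  assumes "compact S" and "convex S" and "S \<noteq> {}"
  shows "y \<in> S \<longleftrightarrow> (LEAST v. v \<in> S) \<le> y \<and> y \<le> (GREATEST v. v \<in> S)"
proof -
  obtain p where p: "p \<in> S" "\<And>v. v \<in> S \<Longrightarrow> p \<le> v"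
    using compact_attains_inf[of S] assms by auto
  obtain q where q: "q \<in> S" "\<And>v. v \<in> S \<Longrightarrow> v \<le> q"
    using compact_attains_sup[of S] assms by auto
  have "(LEAST v. v \<in> S) = p" "(GREATEST v. v \<in> S) = q"
    using p q by (auto intro: Least_equality Greatest_equality)
  moreover have "y \<in> S" if "p \<le> y" "y \<le> q"
    using assms(2) p(1) q(1) that
    by (meson is_interval_convex_1 mem_is_interval_1_I)
  ultimately show ?thesis
    using p q by auto
qed

lemma polytope_max_region:
  fixes D :: "(real^'n) set" and w :: "'d::finite \<Rightarrow> real^'n"
  assumes "polyhedron D" and "bounded D"
  shows "polytope (max_region D w b k)"
proof -
  \<comment> \<open>Each comparison of two affine functions is a closed halfspace, and the index
    type is finite, so only finitely many of them cut \<open>D\<close>.\<close>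
  have "max_region D w b k = D \<inter> (\<Inter>l\<in>-{k}. {x. (w k - w l) \<bullet> x \<ge> b l - b k})"
    by (auto simp: max_region_def algebra_simps)
  moreover have "polyhedron (\<Inter>l\<in>-{k}. {x. (w k - w l) \<bullet> x \<ge> b l - b k})"
    by (intro polyhedron_Inter) (auto intro: polyhedron_halfspace_ge)
  ultimately have "polyhedron (max_region D w b k)"
    using assms(1) by auto
  moreover have "bounded (max_region D w b k)"
    using assms(2) by (rule bounded_subset) (auto simp: max_region_def)
  ultimately show ?thesis
    by (simp add: polytope_eq_bounded_polyhedron)
qed

text \<open>This matters even for multiplier zero: \<open>scale_set 0\<close> of a nonempty region
  is the origin alone, but of an empty region it is empty, and the description of the hull used
  below takes a point from every piece.\<close>

lemma max_region_nonempty: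
  assumes "irreducible_on D w b"
  shows "max_region D w b k \<noteq> {}"
proof -
  obtain x where "x \<in> D" "\<And>l. l \<noteq> k \<Longrightarrow> affine_fun w b l x < affine_fun w b k x"
    using assms unfolding irreducible_on_def by blast
  then have "x \<in> max_region D w b k"
    by (force simp: max_region_def affine_fun_def intro: less_imp_le)
  then show ?thesis by blast
qed

lemma polytope_cayley_piece:
  fixes D :: "(real^'n) set" and w :: "'d::finite \<Rightarrow> real^'n"
  assumes "polyhedron D" and "bounded D"
  shows "polytope {(x, affine_fun w b k x, axis k 1 :: real^'d) | x. x \<in> max_region D w b k}"
proof -
  \<comment> \<open>The piece is an affine image of the region: \<open>?h\<close> is the linear
    part, and the translation by \<open>(0, b k, axis k 1)\<close> adds the constants.\<close>
  let ?h = "\<lambda>x. (x, w k \<bullet> x, 0 :: real^'d)"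
  have "linear ?h"
    by (rule linearI) (auto simp: inner_right_distrib)
  then have "polytope ((+) (0, b k, axis k 1) ` ?h ` max_region D w b k)"
    using polytope_linear_image[OF _ polytope_max_region[OF assms]]
    by (simp add: polytope_translation_eq)
  moreover have "{(x, affine_fun w b k x, axis k 1 :: real^'d) | x. x \<in> max_region D w b k} =
      (+) (0, b k, axis k 1) ` ?h ` max_region D w b k"
    by (auto simp: affine_fun_def image_iff)
  ultimately show ?thesis by simp
qed

lemma polytope_R_cayley:
  assumes "polyhedron D" and "bounded D"
  shows "polytope (R_cayley D w b)"
  unfolding R_cayley_def
  by (intro polytope_convex_hull_UN polytope_cayley_piece assms) simp

text \<open>The unit vectors in the last component record the multipliers, and scaling an affine
  function value by \<open>z $ k\<close> gives exactly the homogenised summand that occurs in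
  \<open>g_values\<close>.\<close>

lemma sum_scaleR_cayley_point:
  fixes z :: "real^'d::finite"
  shows "(\<Sum>k\<in>UNIV. z $ k *\<^sub>R (p k, affine_fun w b k (p k), axis k 1 :: real^'d)) =
    ((\<Sum>k\<in>UNIV. z $ k *\<^sub>R p k),
     (\<Sum>k\<in>UNIV. w k \<bullet> (z $ k *\<^sub>R p k) + b k * z $ k), z)"
proof -
  have "(\<Sum>k\<in>UNIV. z $ k *\<^sub>R axis k 1) = z"
    using basis_expansion[of z] by (simp add: scalar_mult_eq_scaleR)
  then show ?thesis
    by (simp add: prod_eq_iff fst_sum snd_sum affine_fun_def algebra_simps)
qed

lemma mem_R_cayley_iff:
  fixes D :: "(real^'n) set" and w :: "'d::finite \<Rightarrow> real^'n"
  assumes "polyhedron D" and "bounded D" and "irreducible_on D w b"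
  shows "(x, y, z) \<in> R_cayley D w b \<longleftrightarrow> z \<in> unit_simplex \<and> y \<in> g_values D w b x z"
    (is "?lhs \<longleftrightarrow> ?rhs")
proof -
  let ?M = "max_region D w b"
  let ?pt = "\<lambda>k x. (x, affine_fun w b k x, axis k 1 :: real^'d)"
  define S where "S k = {?pt k x | x. x \<in> ?M k}" for k
  have "\<forall>k\<in>UNIV. convex (S k) \<and> S k \<noteq> {}"
    using polytope_cayley_piece[OF assms(1,2)] max_region_nonempty[OF assms(3)]
    by (auto simp: S_def intro: polytope_imp_convex)
  \<comment> \<open>As every piece is convex and nonempty, one point per piece suffices in a convex
    combination.\<close>
  then have hull: "R_cayley D w b = {\<Sum>k\<in>UNIV. c k *\<^sub>R s k | c s.
      (\<forall>k\<in>UNIV. 0 \<le> c k) \<and> sum c UNIV = 1 \<and> (\<forall>k\<in>UNIV. s k \<in> S k)}"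
    unfolding R_cayley_def S_def[symmetric] by (intro convex_hull_finite_union) auto
  show ?thesis
  proof
    assume ?lhs
    then obtain c s where c: "\<And>k. 0 \<le> c k" "sum c UNIV = 1" and s: "\<And>k. s k \<in> S k"
      and eq: "(x, y, z) = (\<Sum>k\<in>UNIV. c k *\<^sub>R s k)"
      unfolding hull by auto
    have "\<forall>k. \<exists>p. p \<in> ?M k \<and> s k = ?pt k p"
      using s by (auto simp: S_def)
    then obtain p where p: "\<And>k. p k \<in> ?M k" "\<And>k. s k = ?pt k (p k)"
      by metis
    \<comment> \<open>With the multipliers packed into a vector, comparing last components yields
      that this vector is \<open>z\<close>.\<close>
    let ?c = "vec_lambda c"
    have "(x, y, z) = (\<Sum>k\<in>UNIV. ?c $ k *\<^sub>R ?pt k (p k))"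
      using eq p(2) by simp
    then have zc: "z = ?c" and x: "x = (\<Sum>k\<in>UNIV. z $ k *\<^sub>R p k)"
      and y: "y = (\<Sum>k\<in>UNIV. w k \<bullet> (z $ k *\<^sub>R p k) + b k * z $ k)"
      unfolding sum_scaleR_cayley_point by auto
    have "z \<in> unit_simplex"
      using c by (simp add: zc unit_simplex_def)
    moreover have "y \<in> g_values D w b x z"
      unfolding g_values_def scale_set_def using x y p(1)
      by (intro CollectI exI[of _ "\<lambda>k. z $ k *\<^sub>R p k"]) auto
    ultimately show ?rhs by blast
  next
    assume r: ?rhs
    then obtain xt where y: "y = (\<Sum>k\<in>UNIV. w k \<bullet> xt k + b k * z $ k)"
      and x: "x = (\<Sum>k\<in>UNIV. xt k)" and "\<forall>k. xt k \<in> scale_set (z $ k) (?M k)"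
      unfolding g_values_def by auto
    \<comment> \<open>Dividing \<open>xt k\<close> by \<open>z $ k\<close> would fail when the
      latter is zero; membership in the image \<open>scale_set\<close> supplies a point in every
      case.\<close>
    then have "\<forall>k. \<exists>p. p \<in> ?M k \<and> xt k = z $ k *\<^sub>R p"
      by (auto simp: scale_set_def)
    then obtain p where p: "\<And>k. p k \<in> ?M k" "\<And>k. xt k = z $ k *\<^sub>R p k"
      by metis
    have "(x, y, z) = (\<Sum>k\<in>UNIV. z $ k *\<^sub>R ?pt k (p k))"
      unfolding sum_scaleR_cayley_point using x y p(2) by simp
    moreover have "\<And>k. ?pt k (p k) \<in> S k"
      using p(1) by (auto simp: S_def)
    ultimately show ?lhs
      unfolding hull using r
      by (intro CollectI exI[of _ "\<lambda>k. z $ k"] exI[of _ "\<lambda>k. ?pt k (p k)"])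
        (auto simp: unit_simplex_def)
  qed
qed

text \<open>\<open>R_ideal\<close> demands that \<open>x\<close> lie in \<open>D\<close>. On the
  Cayley side this follows because projection commutes with convex hulls and the regions lie in the
  convex set \<open>D\<close>.\<close>

lemma fst_R_cayley_subset:
  fixes D :: "(real^'n) set" and w :: "'d::finite \<Rightarrow> real^'n"
  assumes "convex D"
  shows "fst ` R_cayley D w b \<subseteq> D"
proof -
  have "fst ` R_cayley D w b =
      convex hull (fst ` (\<Union>k. {(x, affine_fun w b k x, axis k 1 :: real^'d) | x. x \<in> max_region D w b k}))"
    unfolding R_cayley_def by (rule convex_hull_linear_image[OF linear_fst])
  also have "\<dots> \<subseteq> D"
    using assms by (intro hull_minimal) (auto simp: max_region_def)
  finally show ?thesis .
qed

text \<open>Fixing the outer coordinates intersects \<open>R\<close> with a closed set, and the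
  projection to the middle one is continuous. A convex combination of two points that agree in the
  outer coordinates keeps those coordinates.\<close>

lemma compact_convex_section:
  fixes R :: "('a::real_normed_vector \<times> 'b::real_normed_vector \<times> 'c::real_normed_vector) set"
  assumes "compact R" and "convex R"
  shows "compact {y. (x, y, z) \<in> R}" and "convex {y. (x, y, z) \<in> R}"
proof -
  have "{y. (x, y, z) \<in> R} = (fst \<circ> snd) ` (R \<inter> ({x} \<times> UNIV \<times> {z}))"
    by force
  moreover have "compact (R \<inter> ({x} \<times> UNIV \<times> {z}))"
    using assms(1) by (intro compact_Int_closed closed_Times) auto
  ultimately show "compact {y. (x, y, z) \<in> R}"
    by (auto intro!: compact_continuous_image continuous_intros simp: comp_def)
  show "convex {y. (x, y, z) \<in> R}"
  proof (rule convexI)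
    fix y y' u v
    assume y: "y \<in> {y. (x, y, z) \<in> R}" "y' \<in> {y. (x, y, z) \<in> R}"
      and uv: "0 \<le> u" "0 \<le> v" "u + v = (1::real)"
    then have "u *\<^sub>R (x, y, z) + v *\<^sub>R (x, y', z) \<in> R"
      using assms(2) by (intro convexD) auto
    moreover have "u *\<^sub>R x + v *\<^sub>R x = x" "u *\<^sub>R z + v *\<^sub>R z = z"
      using uv(3) by (simp_all flip: scaleR_add_left)
    ultimately show "u *\<^sub>R y + v *\<^sub>R y' \<in> {y. (x, y, z) \<in> R}"
      by simp
  qed
qed

theorem proposition3:
  fixes D :: "(real^'n) set"
    and w :: "'d::finite \<Rightarrow> real^'n"
    and b :: "'d \<Rightarrow> real"
  assumes "polyhedron D" and "bounded D"
    and "irreducible_on D w b"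
  shows "polyhedron (R_ideal D w b) \<and> R_ideal D w b = R_cayley D w b"
proof -
  let ?R = "R_cayley D w b"
  have R: "polytope ?R"
    using assms(1,2) by (rule polytope_R_cayley)
  have bounds: "g_lower D w b x z \<le> ereal y \<and> ereal y \<le> g_upper D w b x z
      \<longleftrightarrow> y \<in> g_values D w b x z" if "z \<in> unit_simplex" for x y z
  proof (cases "g_values D w b x z = {}")
    case False
    have "g_values D w b x z = {y. (x, y, z) \<in> ?R}"
      using that mem_R_cayley_iff[OF assms] by blast
    then have "compact (g_values D w b x z)" "convex (g_values D w b x z)"
      using R by (simp_all add: compact_convex_section polytope_imp_compact polytope_imp_convex)
    from compact_convex_real_iff_between_Least_Greatest[OF this False, of y] False
    show ?thesis
      by (simp add: g_lower_def g_upper_def)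
  \<comment> \<open>Without any feasible decomposition the lower bound is \<infinity>, so no real
    \<open>y\<close> satisfies the inequalities.\<close>
  qed (simp add: g_lower_def g_upper_def)
  have "x \<in> D" if "(x, y, z) \<in> ?R" for x y z
    using subsetD[OF fst_R_cayley_subset[OF polyhedron_imp_convex[OF assms(1)]] imageI[OF that]]
    by simp
  then have iff: "(x, y, z) \<in> R_ideal D w b \<longleftrightarrow> (x, y, z) \<in> ?R" for x y z
    using bounds[of z x y] mem_R_cayley_iff[OF assms, of x y z] unfolding R_ideal_def by auto
  have "R_ideal D w b = ?R"
  proof (rule set_eqI)
    show "p \<in> R_ideal D w b \<longleftrightarrow> p \<in> ?R" for p
      using iff by (cases p) simp
  qed
  then show ?thesis
    using R by (simp add: polytope_imp_polyhedron)
qed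

end
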